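(* Let $\mathbf R\subset\mathbb R^2$ be a region of area $1$ and let $O$ be a point in the interior of $\mathbf R$. Take $O$ as the origin of polar coordinates and assume that the boundary $\partial\mathbf R$ is the curve $\{(r(\theta),\theta):\theta\in[0,2\pi]\}$, where $r$ is a positive, continuous, piecewise differentiable function. Let $A,B,C$ be independent points, each uniformly distributed in $\mathbf R$, and let $\mathcal P$ be the probability that the triangle $\triangle ABC$ contains $O$. Let $f$ be the density on $\partial\mathbf R$ (with respect to arc length) defined by the condition that $\int_{\overset{\frown}{st}} f(x)\,dx=\frac12\int_{\theta_s}^{\theta_t} r(\theta)^2\,d\theta$ for all boundary points $s=(r(\theta_s),\theta_s)$, $t=(r(\theta_t),\theta_t)$ with $\theta_s\le\theta_t$ and $\theta_t-\theta_s\le 2\pi$. Here $\overset{\frown}{st}$ is the arc of $\partial\mathbf R$ from $s$ to $t$, traversed counterclockwise. In particular $\int_{\partial\mathbf R}f=1$. Define the involution $F:\partial\mathbf R\to\partial\mathbf R$ by $F((r(\theta),\theta))=(r(\theta+\pi),\theta+\pi)$. For $t\in\partial\mathbf R$, let $H(t)=\int_{\overset{\frown}{tF(t)}}f(x)\,dx$; this is the area of the part of $\mathbf R$ lying to the right of the line from $t$ to $F(t)$. For a point $\mathbf u\in\partial\mathbf R$, put $\mathbf v=F(\mathbf u)$ and $G(t)=\int_{\overset{\frown}{\mathbf u t}}f(x)\,dx$. Then the following hold. (i) For every $\mathbf u\in\partial\mathbf R$, $$\mathcal P=-G(\mathbf v)^2\,[3-2G(\mathbf v)]+6\int_{\overset{\frown}{\mathbf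 u\mathbf v}}H(t)\,[1-H(t)]\,f(t)\,dt .$$ (ii) For every $\mathbf u\in\partial\mathbf R$, with $x=G(\mathbf v)$, $$\mathcal P=\frac14-\frac{(1-2x)^3}{4}-6\int_{\overset{\frown}{\mathbf u\mathbf v}}\Big[\frac12-H(t)\Big]^2 f(t)\,dt .$$ (iii) There exists $\mathbf u\in\partial\mathbf R$ such that $$\mathcal P=\frac14-6\int_{\overset{\frown}{\mathbf u\mathbf v}}\Big[\frac12-H(t)\Big]^2 f(t)\,dt .$$ (iv) Independently of any choice of $\mathbf u$, $$\mathcal P=-\frac12+3\int_{\partial\mathbf R}H(t)\,[1-H(t)]\,f(t)\,dt=\frac14-3\int_{\partial\mathbf R}\Big[\frac12-H(t)\Big]^2 f(t)\,dt .$$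
   Context: All integrals of the form $\int \varphi(t)f(t)\,dt$ over an arc of $\partial\mathbf R$ are taken with respect to the measure $f(t)\,dt$. Equivalently, in the polar parametrization this measure is $\frac12 r(\theta)^2\,d\theta$. Arcs of $\partial\mathbf R$ are always traversed counterclockwise. *)

theory Defs
  imports "HOL-Analysis.Analysis"
begin

text \<open>Points of the plane are complex numbers; O is the origin 0.
  The region bounded by the polar curve rho = r theta (r 2pi-periodic).\<close>
definition polar_region :: "(real \<Rightarrow> real) \<Rightarrow> complex set" where
  "polar_region r = {complex_of_real \<rho> * cis \<theta> | \<rho> \<theta>. 0 \<le> \<rho> \<and> \<rho> \<le> r \<theta>}"

definition triangle_prob :: "complex set \<Rightarrow> real" where
  "triangle_prob R =
     measure lborel {(a :: complex, b :: complex, c :: complex).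
        a \<in> R \<and> b \<in> R \<and> c \<in> R \<and> 0 \<in> convex hull {a, b, c}} / (measure lborel R) ^ 3"

text \<open>Integral of phi against f over the counterclockwise arc from angle a to angle b,
  i.e. against (1/2) r(theta)^2 d theta.\<close>
definition arc_int :: "(real \<Rightarrow> real) \<Rightarrow> real \<Rightarrow> real \<Rightarrow> (real \<Rightarrow> real) \<Rightarrow> real" where
  "arc_int r a b \<phi> = integral {a..b} (\<lambda>\<theta>. \<phi> \<theta> * (r \<theta>)\<^sup>2 / 2)"

definition Hfun :: "(real \<Rightarrow> real) \<Rightarrow> real \<Rightarrow> real" where
  "Hfun r \<theta> = arc_int r \<theta> (\<theta> + pi) (\<lambda>_. 1)"

end

theory Submission
  imports Defs
begin

text \<open>
  Write \<open>[a, b]\<close> for the cross product and \<open>g = r\<^sup>2 / 2\<close>. For three points in general position, the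
  signs of \<open>[a, b]\<close>, \<open>[b, c]\<close>, \<open>[c, a]\<close> either all agree, and then
  \<open>[b, c] a + [c, a] b + [a, b] c = 0\<close> puts the origin into the triangle, or exactly one vertex has
  both others on its left, and then the triangle misses the origin. In polar coordinates the points
  of the region to the left of a point of angle \<open>\<theta>\<close> have area \<open>H \<theta>\<close>, so the probability is
  \<open>1 - 3 \<integral> H\<^sup>2 g\<close>, taken over any full turn. Since \<open>H (\<theta> + \<pi>) = 1 - H \<theta>\<close> and
  \<open>H' \<theta> = g (\<theta> + \<pi>) - g \<theta>\<close>, the second half turn folds onto the first up to the exact integrand
  \<open>(1 - H)\<^sup>2 H'\<close>.
\<close>

subsection \<open>Polar coordinates in the complex plane\<close>

lemma measurable_vec2 [measurable]:
  "(\<lambda>(x, y). vector [x, y] :: real^2) \<in> (lborel \<Otimes>\<^sub>M lborel) \<rightarrow>\<^sub>M borel"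
proof -
  have "(\<lambda>(x, y). vector [x, y] :: real^2) = (\<lambda>p. fst p *\<^sub>R axis 1 1 + snd p *\<^sub>R axis 2 1)"
    by (auto simp: fun_eq_iff vec_eq_iff forall_2 axis_def)
  then show ?thesis by simp
qed

text \<open>Change of variables with a determinant takes place on \<open>real^2\<close>, iterated
  integration on a product of lines. This identification carries integrals between the two.\<close>

lemma lborel_vec2:
  "distr (lborel \<Otimes>\<^sub>M lborel) borel (\<lambda>(x, y). vector [x, y] :: real^2) = lborel"
proof (rule lborel_eqI[symmetric])
  fix l u :: "real^2"
  assume le: "\<And>b. b \<in> Basis \<Longrightarrow> l \<bullet> b \<le> u \<bullet> b"
  have le': "l $ i \<le> u $ i" for i
    using le[of "axis i 1"] by (simp add: cart_eq_inner_axis)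
  have "(\<lambda>(x, y). vector [x, y]) -` box l u \<inter> space (lborel \<Otimes>\<^sub>M lborel)
    = box (l $ 1) (u $ 1) \<times> box (l $ 2) (u $ 2)"
    by (auto simp: mem_box_cart forall_2 space_pair_measure)
  moreover have "(\<Prod>b\<in>Basis. (u - l) \<bullet> b) = (u $ 1 - l $ 1) * (u $ 2 - l $ 2)"
    by (simp add: Basis_vec_def UNIV_2 axis_eq_axis inner_axis)
  ultimately show "emeasure (distr (lborel \<Otimes>\<^sub>M lborel) borel (\<lambda>(x, y). vector [x, y])) (box l u)
      = ennreal (\<Prod>b\<in>Basis. (u - l) \<bullet> b)"
    using le' by (simp add: emeasure_distr lborel.emeasure_pair_measure_Times ennreal_mult)
qed simp

text \<open>Dividing by \<open>cis c\<close> rotates the window to one starting at 0, where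
  \<open>Arg2pi\<close> supplies the angle. The start \<open>c\<close> stays free because later
  integrals choose the window to suit the point under consideration.\<close>

lemma ex_polar_form_window:
  fixes z :: complex
  obtains \<theta> where "c \<le> \<theta>" "\<theta> < c + 2 * pi" "z = of_real (cmod z) * cis \<theta>"
proof
  let ?w = "z / cis c"
  have "?w = of_real (cmod ?w) * cis (Arg2pi ?w)"
    using Arg2pi[of ?w] unfolding is_Arg_def by (simp only: cis_conv_exp)
  then show "z = of_real (cmod z) * cis (c + Arg2pi ?w)"
    by (simp add: norm_divide field_simps flip: cis_mult)
qed (use Arg2pi[of "z / cis c"] in auto)

lemma cis_inj_window:
  assumes "cis s = cis t" "c \<le> s" "s < c + 2 * pi" "c \<le> t" "t < c + 2 * pi"
  shows "s = t"
proof -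
  have "cis (s - t) = 1"
    using assms(1) by (simp flip: cis_divide)
  then have "cos (s - t) = 1" by (simp add: complex_eq_iff)
  then obtain n :: int where "s - t = of_int n * (2 * pi)"
    by (auto simp: cos_one_2pi_int)
  moreover have "\<bar>s - t\<bar> < 2 * pi" using assms by auto
  ultimately have "\<bar>of_int n\<bar> * (2 * pi) < 1 * (2 * pi)" by (simp add: abs_mult)
  then have "\<bar>of_int n :: real\<bar> < 1" by (simp only: mult_less_cancel_right) auto
  then have "n = 0" by linarith
  with \<open>s - t = _\<close> show ?thesis by simp
qed

text \<open>Positive radii and a half-open full turn make the polar map injective, at the price of
  missing only the origin.\<close>

definition polar_window :: "real \<Rightarrow> (real \<times> real) set" where
  "polar_window c = {0<..} \<times> {c..<c + 2 * pi}"

lemma has_derivative_polar_vec2: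
  fixes p :: "real^2"
  shows
  "((\<lambda>p. vector [p $ 1 * cos (p $ 2), p $ 1 * sin (p $ 2)] :: real^2) has_derivative
    (\<lambda>h. vector [h $ 1 * cos (p $ 2) - p $ 1 * (sin (p $ 2) * h $ 2),
                 h $ 1 * sin (p $ 2) + p $ 1 * (cos (p $ 2) * h $ 2)])) (at p within S)"
proof -
  have c: "((\<lambda>p::real^2. p $ i) has_derivative (\<lambda>h. h $ i)) (at p within S)" for i
    by (simp add: bounded_linear_imp_has_derivative bounded_linear_vec_nth)
  show ?thesis
    by (subst has_derivative_componentwise_within)
       (auto simp: Basis_vec_def UNIV_2 inner_axis intro!: derivative_eq_intros c)
qed

lemma det_polar_derivative:
  "det (matrix (\<lambda>h::real^2. vector [h $ 1 * cos t - r * (sin t * h $ 2),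
                 h $ 1 * sin t + r * (cos t * h $ 2)] :: real^2)) = r"
proof -
  have "r * (cos t * cos t) + r * (sin t * sin t) = r"
    by (metis distrib_left mult.right_neutral power2_eq_square sin_cos_squared_add2)
  then show ?thesis
   by (simp add: det_2 matrix_def axis_def mult_ac)
qed

text \<open>Lebesgue measure is determined by its values on boxes. For one box, the polar map is
  injective on the part of the window over it, and its Jacobian determinant is the radius, so
  integrating the radius over that part yields the area of the box.\<close>

lemma lborel_complex_polar:
  "lborel = distr (density (lborel \<Otimes>\<^sub>M lborel) (\<lambda>p. ennreal (fst p) * indicator (polar_window c) p))
              borel (\<lambda>p. complex_of_real (fst p) * cis (snd p))"
proof (rule lborel_eqI)
  fix l u :: complex
  assume le: "\<And>b. b \<in> Basis \<Longrightarrow> l \<bullet> b \<le> u \<bullet> b"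
  let ?T = "polar_window c" and ?P = "\<lambda>p. complex_of_real (fst p) * cis (snd p)"
  define g where "g = (\<lambda>p::real^2. vector [p $ 1 * cos (p $ 2), p $ 1 * sin (p $ 2)] :: real^2)"
  define l' u' where "l' = (vector [Re l, Im l] :: real^2)" and "u' = (vector [Re u, Im u] :: real^2)"
  \<comment> \<open>The part of the window lying over the box, transported to \<open>real^2\<close>;
    it need not be a product set.\<close>
  define S where "S = {p. (p $ 1, p $ 2) \<in> ?T \<and> g p \<in> box l' u'}"
  have le': "Re l \<le> Re u" "Im l \<le> Im u"
    using le[of 1] le[of \<i>] by (auto simp: Basis_complex_def)
  let ?m = "(Re u - Re l) * (Im u - Im l)"
  have [measurable]: "(\<lambda>p::real^2. p $ i) \<in> borel_measurable borel" for i
    by (intro borel_measurable_continuous_onI continuous_intros)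
  have gc: "continuous_on UNIV g"
    unfolding g_def
    by (rule has_derivative_continuous_on) (rule has_derivative_polar_vec2)
  have [measurable]: "g \<in> borel_measurable borel"
    by (intro borel_measurable_continuous_onI gc)
  have [measurable]: "?T \<in> sets (borel \<Otimes>\<^sub>M borel)" "?T \<in> sets (lborel \<Otimes>\<^sub>M lborel)"
    unfolding polar_window_def by auto
  have [measurable]: "?T \<in> sets borel"
    unfolding polar_window_def by (auto simp flip: borel_prod)
  have [measurable]: "?P \<in> (lborel \<Otimes>\<^sub>M lborel) \<rightarrow>\<^sub>M borel"
    unfolding lborel_prod by (simp, intro borel_measurable_continuous_onI continuous_intros)
  have V: "?P -` box l u \<in> sets (lborel \<Otimes>\<^sub>M lborel)"
    using measurable_sets[of ?P "lborel \<Otimes>\<^sub>M lborel" borel "box l u"] by (simp add: space_pair_measure)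
  have S [measurable]: "S \<in> sets borel"
    unfolding S_def by measurable
  have inj: "inj_on g S"
  proof (rule inj_onI)
    fix p q assume pq: "p \<in> S" "q \<in> S" "g p = g q"
    then have pos: "p $ 1 > 0" "q $ 1 > 0" by (auto simp: S_def polar_window_def)
    have eq: "of_real (p $ 1) * cis (p $ 2) = of_real (q $ 1) * cis (q $ 2)"
      using pq(3) by (simp add: g_def vec_eq_iff forall_2 complex_eq_iff)
    then have "cmod (of_real (p $ 1) * cis (p $ 2)) = cmod (of_real (q $ 1) * cis (q $ 2))" by simp
    then have 1: "p $ 1 = q $ 1" using pos by (simp add: norm_mult)
    with eq pos have "cis (p $ 2) = cis (q $ 2)" by simp
    then have "p $ 2 = q $ 2"
      by (rule cis_inj_window[where c = c]) (use pq in \<open>auto simp: S_def polar_window_def\<close>)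
    with 1 show "p = q" by (simp add: vec_eq_iff forall_2)
  qed
  have img: "g ` S = box l' u' - {0}"
  proof (intro equalityI subsetI)
    fix x assume "x \<in> g ` S"
    then show "x \<in> box l' u' - {0}"
      by (auto simp: S_def g_def polar_window_def vec_eq_iff forall_2)
         (metis mult_eq_0_iff less_irrefl sin_zero_abs_cos_one abs_zero zero_neq_one)
  next
    fix x assume x: "x \<in> box l' u' - {0}"
    obtain t where t: "c \<le> t" "t < c + 2 * pi"
       "Complex (x $ 1) (x $ 2) = of_real (cmod (Complex (x $ 1) (x $ 2))) * cis t"
      by (rule ex_polar_form_window)
    let ?p = "vector [cmod (Complex (x $ 1) (x $ 2)), t] :: real^2"
    have "Complex (x $ 1) (x $ 2) \<noteq> 0"
      using x by (auto simp: complex_eq_iff vec_eq_iff forall_2)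
    then have "(?p $ 1, ?p $ 2) \<in> ?T"
      using t by (simp add: polar_window_def)
    moreover have "g ?p = x"
      using t(3) by (simp add: g_def vec_eq_iff forall_2 complex_eq_iff)
    ultimately show "x \<in> g ` S"
      using x by (intro image_eqI[of _ _ ?p]) (auto simp: S_def)
  qed
  \<comment> \<open>The image of \<open>S\<close> lacks at most the origin, which is a null
    set.\<close>
  have "emeasure lborel (box l' u' - {0}) = emeasure lborel (box l' u')"
    by (subst emeasure_Diff_null_set) auto
  also have "\<dots> = ennreal (\<Prod>b\<in>Basis. (u' - l') \<bullet> b)"
    using le' by (subst emeasure_lborel_box)
      (auto simp: Basis_vec_def UNIV_2 inner_axis l'_def u'_def)
  also have "(\<Prod>b\<in>Basis. (u' - l') \<bullet> b) = ?m"
    by (simp add: Basis_vec_def UNIV_2 axis_eq_axis inner_axis l'_def u'_def)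
  finally have em: "emeasure lborel (g ` S) = ennreal ?m" by (simp add: img)
  have gS: "g ` S \<in> sets borel" by (simp add: img)
  have "g ` S \<in> lmeasurable \<and> measure lebesgue (g ` S) = ?m"
    using em gS le' by (auto simp: fmeasurable_def measure_def)
  \<comment> \<open>The change of variables theorem is read backwards: the measure of the image is
    known, and it gives existence and value of the integral of the Jacobian over
    \<open>S\<close>.\<close>
  then have hi: "((\<lambda>p. \<bar>p $ 1\<bar>) has_integral ?m) S"
    by (subst (asm) has_measure_differentiable_image[OF _ has_derivative_polar_vec2[folded g_def] inj])
       (auto simp: det_polar_derivative)
  have "((\<lambda>p. \<bar>p $ 1\<bar> * indicator S p) has_integral ?m) UNIV"
    using hi has_integral_restrict_UNIV[of S "\<lambda>p. \<bar>p $ 1\<bar>" ?m]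
    by (simp add: indicator_def of_bool_def if_distrib cong: if_cong)
  then have nn: "(\<integral>\<^sup>+p. \<bar>p $ 1\<bar> * indicator S p \<partial>lborel) = ennreal ?m"
    by (intro nn_integral_has_integral_lborel) auto
  have gv: "g (vector [x, y]) \<in> box l' u' \<longleftrightarrow> of_real x * cis y \<in> box l u" for x y
    by (auto simp: g_def mem_box_cart forall_2 in_box_complex_iff l'_def u'_def)
  have "emeasure (distr (density (lborel \<Otimes>\<^sub>M lborel) (\<lambda>p. ennreal (fst p) * indicator ?T p)) borel ?P) (box l u)
    = (\<integral>\<^sup>+p. ennreal (fst p) * indicator ?T p * indicator (?P -` box l u) p \<partial>(lborel \<Otimes>\<^sub>M lborel))"
    by (subst emeasure_distr, simp, simp, subst emeasure_density)
       (use V in \<open>auto simp: space_pair_measure\<close>)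
  also have "\<dots> = (\<integral>\<^sup>+p. \<bar>p $ 1\<bar> * indicator S p \<partial>distr (lborel \<Otimes>\<^sub>M lborel) borel (\<lambda>(x, y). vector [x, y] :: real^2))"
    by (subst nn_integral_distr)
       (auto intro!: nn_integral_cong simp: S_def gv polar_window_def indicator_def)
  also have "\<dots> = ennreal ?m"
    unfolding lborel_vec2 using nn by simp
  also have "?m = (\<Prod>b\<in>Basis. (u - l) \<bullet> b)"
    by (simp add: Basis_complex_def)
  finally show "emeasure (distr (density (lborel \<Otimes>\<^sub>M lborel) (\<lambda>p. ennreal (fst p) * indicator ?T p)) borel ?P) (box l u)
    = (\<Prod>b\<in>Basis. (u - l) \<bullet> b)" .
qed simp

text \<open>The angle is the outer variable, so that integrands depending only on the angle can be
  integrated radially first.\<close>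

lemma nn_integral_complex_polar:
  assumes [measurable]: "f \<in> borel_measurable borel"
  shows "(\<integral>\<^sup>+z. f z \<partial>lborel) =
    (\<integral>\<^sup>+\<theta>. (\<integral>\<^sup>+\<rho>. ennreal \<rho> * f (complex_of_real \<rho> * cis \<theta>) * indicator {0<..} \<rho> \<partial>lborel)
       * indicator {c..<c + 2 * pi} \<theta> \<partial>lborel)"
proof -
  let ?P = "\<lambda>p. complex_of_real (fst p) * cis (snd p)"
  have [measurable]: "polar_window c \<in> sets (borel \<Otimes>\<^sub>M borel)" "polar_window c \<in> sets (lborel \<Otimes>\<^sub>M lborel)"
    unfolding polar_window_def by auto
  have [measurable]: "?P \<in> (lborel \<Otimes>\<^sub>M lborel) \<rightarrow>\<^sub>M borel"
    unfolding lborel_prod by (simp, intro borel_measurable_continuous_onI continuous_intros)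
  have "(\<integral>\<^sup>+z. f z \<partial>lborel) =
     (\<integral>\<^sup>+p. ennreal (fst p) * indicator (polar_window c) p * f (?P p) \<partial>(lborel \<Otimes>\<^sub>M lborel))"
    by (subst lborel_complex_polar[of c], subst nn_integral_distr)
       (auto simp: nn_integral_density)
  also have "\<dots> = (\<integral>\<^sup>+\<theta>. \<integral>\<^sup>+\<rho>. ennreal \<rho> * indicator (polar_window c) (\<rho>, \<theta>) * f (?P (\<rho>, \<theta>)) \<partial>lborel \<partial>lborel)"
    by (subst lborel_pair.nn_integral_snd[symmetric]) (auto simp: case_prod_beta')
  also have "\<dots> = (\<integral>\<^sup>+\<theta>. (\<integral>\<^sup>+\<rho>. ennreal \<rho> * f (complex_of_real \<rho> * cis \<theta>) * indicator {0<..} \<rho> \<partial>lborel)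
       * indicator {c..<c + 2 * pi} \<theta> \<partial>lborel)"
    by (intro nn_integral_cong) (auto simp: indicator_def polar_window_def intro!: nn_integral_cong)
  finally show ?thesis .
qed

lemma nn_integral_radial:
  assumes "0 \<le> R"
  shows "(\<integral>\<^sup>+\<rho>. ennreal \<rho> * indicator {0<..R} \<rho> \<partial>lborel) = ennreal (R\<^sup>2 / 2)"
proof -
  have "(\<integral>\<^sup>+\<rho>. ennreal \<rho> * indicator {0<..R} \<rho> \<partial>lborel) = (\<integral>\<^sup>+\<rho>. ennreal \<rho> * indicator {0..R} \<rho> \<partial>lborel)"
    by (intro nn_integral_cong) (auto simp: indicator_def)
  also have "\<dots> = ennreal (R\<^sup>2 / 2 - 0\<^sup>2 / 2)"
    by (rule nn_integral_FTC_Icc) (use assms in \<open>auto intro!: derivative_eq_intros\<close>)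
  finally show ?thesis by simp
qed

section \<open>The region bounded by a polar curve\<close>

lemma periodic_of_int:
  fixes r :: "real \<Rightarrow> 'a"
  assumes "\<And>\<theta>. r (\<theta> + p) = r \<theta>"
  shows "r (\<theta> + of_int n * p) = r \<theta>"
proof (induction n rule: int_induct[where k = 0])
  case (step1 i)
  then show ?case using assms[of "\<theta> + of_int i * p"] by (simp add: algebra_simps)
next
  case (step2 i)
  then show ?case using assms[of "\<theta> + of_int (i - 1) * p"] by (simp add: algebra_simps)
qed simp

locale polar_curve =
  fixes r :: "real \<Rightarrow> real"
  assumes pos: "\<And>\<theta>. r \<theta> > 0"
    and cont: "continuous_on UNIV r"
    and periodic: "\<And>\<theta>. r (\<theta> + 2 * pi) = r \<theta>"
begin

text \<open>A nonzero point has many angles, all differing by full turns; periodicity of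
  \<open>r\<close> makes the radial bound the same for each of them.\<close>

lemma mem_polar_region_iff:
  assumes \<rho>: "0 < \<rho>"
  shows "of_real \<rho> * cis \<theta> \<in> polar_region r \<longleftrightarrow> \<rho> \<le> r \<theta>"
proof
  assume "of_real \<rho> * cis \<theta> \<in> polar_region r"
  then obtain \<rho>' \<theta>' where *: "of_real \<rho> * cis \<theta> = of_real \<rho>' * cis \<theta>'" "0 \<le> \<rho>'" "\<rho>' \<le> r \<theta>'"
    unfolding polar_region_def by blast
  have "\<rho> = \<rho>'"
    using arg_cong[OF *(1), of cmod] *(2) \<rho> by (simp add: norm_mult)
  with * \<rho> have "cis \<theta> = cis \<theta>'" by simp
  then have "cis (\<theta> - \<theta>') = 1" by (simp flip: cis_divide)
  then have "cos (\<theta> - \<theta>') = 1" by (simp add: complex_eq_iff)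
  then obtain n :: int where "\<theta> - \<theta>' = of_int n * (2 * pi)"
    by (auto simp: cos_one_2pi_int)
  then have "\<theta> = \<theta>' + of_int n * (2 * pi)" by simp
  then have "r \<theta> = r \<theta>'" using periodic_of_int[where r = r and p = "2 * pi"] periodic by simp
  with * \<open>\<rho> = \<rho>'\<close> show "\<rho> \<le> r \<theta>" by simp
next
  assume "\<rho> \<le> r \<theta>"
  with \<rho> show "of_real \<rho> * cis \<theta> \<in> polar_region r"
    unfolding polar_region_def by (intro CollectI exI[of _ \<rho>] exI[of _ \<theta>]) simp
qed

text \<open>The region is the continuous image of a rectangle under scaling the boundary point at
  angle \<open>t\<close> by a factor in [0, 1]. Borel measurability and finite area follow from
  this.\<close>

lemma compact_polar_region: "compact (polar_region r)"
proof -
  let ?K = "{0..1} \<times> {0..2 * pi} :: (real \<times> real) set"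
  let ?F = "\<lambda>p. of_real (fst p * r (snd p)) * cis (snd p)"
  have "polar_region r = ?F ` ?K"
  proof (intro equalityI subsetI)
    fix z assume z: "z \<in> polar_region r"
    obtain t where t: "0 \<le> t" "t < 0 + 2 * pi" "z = of_real (cmod z) * cis t"
      by (rule ex_polar_form_window)
    have "cmod z \<le> r t"
    proof (cases "z = 0")
      case False
      with z t mem_polar_region_iff[of "cmod z" t] show ?thesis by simp
    qed (use pos[of t] in simp)
    then show "z \<in> ?F ` ?K"
      using t pos[of t] by (intro image_eqI[of _ _ "(cmod z / r t, t)"]) auto
  next
    fix z assume "z \<in> ?F ` ?K"
    then obtain s t where st: "z = of_real (s * r t) * cis t" "0 \<le> s" "s \<le> 1" by auto
    have "s * r t \<le> r t" "0 \<le> s * r t"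
      using st pos[of t] by (auto intro: mult_left_le_one_le)
    with st show "z \<in> polar_region r" unfolding polar_region_def by blast
  qed
  moreover have "continuous_on ?K ?F"
    by (intro continuous_intros continuous_on_compose2[OF cont]) auto
  ultimately show ?thesis
    by (simp add: compact_continuous_image compact_Times)
qed

lemma polar_region_borel [measurable]: "polar_region r \<in> sets borel"
  using compact_polar_region by (simp add: borel_closed compact_imp_closed)

text \<open>Integrating the radius from 0 to the boundary produces
  \<open>(r \<theta>)\<^sup>2 / 2\<close>: the area integral of a function of direction is an
  integral over the boundary against the given density. The value of \<open>f\<close> at the origin
  does not affect it.\<close>

lemma nn_integral_polar_region:
  assumes [measurable]: "f \<in> borel_measurable borel"
    and f: "\<And>\<rho> \<theta>. 0 < \<rho> \<Longrightarrow> c \<le> \<theta> \<Longrightarrow> \<theta> < c + 2 * pi \<Longrightarrow> f (of_real \<rho> * cis \<theta>) = \<phi> \<theta>"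
  shows "(\<integral>\<^sup>+z\<in>polar_region r. f z \<partial>lborel)
    = (\<integral>\<^sup>+\<theta>\<in>{c..<c + 2 * pi}. \<phi> \<theta> * ennreal ((r \<theta>)\<^sup>2 / 2) \<partial>lborel)"
proof -
  have "(\<integral>\<^sup>+\<rho>. ennreal \<rho> * (f (of_real \<rho> * cis \<theta>) * indicator (polar_region r) (of_real \<rho> * cis \<theta>))
         * indicator {0<..} \<rho> \<partial>lborel) = \<phi> \<theta> * ennreal ((r \<theta>)\<^sup>2 / 2)"
    if \<theta>: "c \<le> \<theta>" "\<theta> < c + 2 * pi" for \<theta>
  proof -
    have "(\<integral>\<^sup>+\<rho>. ennreal \<rho> * (f (of_real \<rho> * cis \<theta>) * indicator (polar_region r) (of_real \<rho> * cis \<theta>))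
         * indicator {0<..} \<rho> \<partial>lborel) = (\<integral>\<^sup>+\<rho>. \<phi> \<theta> * (ennreal \<rho> * indicator {0<..r \<theta>} \<rho>) \<partial>lborel)"
      using \<theta> by (intro nn_integral_cong)
        (auto simp: indicator_def f mem_polar_region_iff mult.commute[of "\<phi> \<theta>"])
    then show ?thesis
      by (simp add: nn_integral_cmult nn_integral_radial less_imp_le[OF pos])
  qed
  then show ?thesis
    by (subst nn_integral_complex_polar[where c = c]) (auto intro!: nn_integral_cong simp: indicator_def)
qed

end

subsection \<open>Triangles containing the origin\<close>

definition cross :: "complex \<Rightarrow> complex \<Rightarrow> real" where
  "cross a b = Re a * Im b - Im a * Re b"

lemma cross_commute: "cross b a = - cross a b"
  by (simp add: cross_def)

lemma cross_polar: "cross (of_real \<rho> * cis \<alpha>) (of_real \<sigma> * cis \<theta>) = \<rho> * \<sigma> * sin (\<theta> - \<alpha>)"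
  by (simp add: cross_def sin_diff algebra_simps)

lemma cross_measurable [measurable (raw)]:
  "f \<in> borel_measurable M \<Longrightarrow> g \<in> borel_measurable M \<Longrightarrow> (\<lambda>x. cross (f x) (g x)) \<in> borel_measurable M"
  unfolding cross_def
  by (intro borel_measurable_diff borel_measurable_times)
     (auto intro: measurable_compose[OF _ borel_measurable_continuous_onI[OF continuous_on_Re[OF continuous_on_id]]]
        measurable_compose[OF _ borel_measurable_continuous_onI[OF continuous_on_Im[OF continuous_on_id]]])

text \<open>Cramer's rule: the linear dependence of three plane vectors, with 2 by 2 minors as
  coefficients.\<close>

lemma cross_sum_zero:
  "cross b c *\<^sub>R a + cross c a *\<^sub>R b + cross a b *\<^sub>R c = 0"
  by (simp add: complex_eq_iff cross_def algebra_simps)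

lemma zero_in_hull_if_same_sign:
  assumes "cross a b > 0" "cross b c > 0" "cross c a > 0"
  shows "0 \<in> convex hull {a, b, c}"
proof -
  let ?s = "cross b c + cross c a + cross a b"
  have "(cross b c / ?s) *\<^sub>R a + (cross c a / ?s) *\<^sub>R b + (cross a b / ?s) *\<^sub>R c
     = (1 / ?s) *\<^sub>R (cross b c *\<^sub>R a + cross c a *\<^sub>R b + cross a b *\<^sub>R c)"
    by (simp add: scaleR_add_right)
  also have "\<dots> = 0" by (simp add: cross_sum_zero)
  finally have "0 = (cross b c / ?s) *\<^sub>R a + (cross c a / ?s) *\<^sub>R b + (cross a b / ?s) *\<^sub>R c" by simp
  moreover have "cross b c / ?s + cross c a / ?s + cross a b / ?s = 1"
    using assms by (simp flip: add_divide_distrib)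
  ultimately show ?thesis
    unfolding convex_hull_3 using assms
    by (intro CollectI exI[of _ "cross b c / ?s"] exI[of _ "cross c a / ?s"] exI[of _ "cross a b / ?s"]) auto
qed

text \<open>Taking the cross product of \<open>a\<close> with a convex combination equal to 0 leaves
  a nonnegative combination of two positive numbers. Both weights must vanish, which forces
  \<open>a = 0\<close>, contrary to \<open>cross a b > 0\<close>.\<close>

lemma zero_notin_hull_if_left:
  assumes "cross a b > 0" "cross a c > 0"
  shows "0 \<notin> convex hull {a, b, c}"
proof
  assume "0 \<in> convex hull {a, b, c}"
  then obtain u v w where uvw: "0 = u *\<^sub>R a + v *\<^sub>R b + w *\<^sub>R c"
     "0 \<le> u" "0 \<le> v" "0 \<le> w" "u + v + w = 1"
    unfolding convex_hull_3 by auto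
  have lin: "cross z 0 = u * cross z a + v * cross z b + w * cross z c" for z
    unfolding uvw(1) by (simp add: cross_def algebra_simps)
  from lin[of a] have "v * cross a b + w * cross a c = 0"
    by (simp add: cross_def)
  with assms uvw have "v = 0" "w = 0"
    by (smt (verit) mult_nonneg_nonneg mult_pos_pos)+
  with uvw have "a = 0" by simp
  with assms show False by (simp add: cross_def)
qed

text \<open>Of the eight sign patterns of \<open>cross a b\<close>, \<open>cross b c\<close>,
  \<open>cross c a\<close>, the two constant ones put the origin into the triangle. In the other
  six, the cyclic sequence passes from negative to positive exactly once, and the vertex shared by
  those two cross products has both others on its left.\<close>

lemma hull_left_partition:
  assumes "cross a b \<noteq> 0" "cross b c \<noteq> 0" "cross c a \<noteq> 0"
  shows "indicator {(a, b, c). 0 \<in> convex hull {a, b, c}} (a, b, c)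
     + of_bool (cross a b > 0) * of_bool (cross a c > 0)
     + of_bool (cross b c > 0) * of_bool (cross b a > 0)
     + of_bool (cross c a > 0) * of_bool (cross c b > 0) = (1 :: ennreal)"
proof -
  have [simp]: "{b, c, a} = {a, b, c}" "{c, a, b} = {a, b, c}" "{a, c, b} = {a, b, c}" by auto
  note L = zero_notin_hull_if_left[of a b c] zero_notin_hull_if_left[of b c a]
    zero_notin_hull_if_left[of c a b] zero_in_hull_if_same_sign[of a b c]
    zero_in_hull_if_same_sign[of a c b]
  have C: "cross b a = - cross a b" "cross c b = - cross b c" "cross a c = - cross c a"
    by (rule cross_commute)+
  show ?thesis
    using assms L unfolding C
    by (cases "cross a b > 0"; cases "cross b c > 0"; cases "cross c a > 0") auto
qed

text \<open>The set is the projection of a closed condition along the compact set of barycentric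
  weights, hence closed; this provides the measurability of the event.\<close>

lemma closed_zero_in_hull:
  "closed {(a :: complex, b, c). 0 \<in> convex hull {a, b, c}}"
proof -
  let ?S = "{p :: real \<times> real. 0 \<le> fst p \<and> 0 \<le> snd p \<and> fst p + snd p \<le> 1}"
  let ?T = "{q :: (real \<times> real) \<times> (complex \<times> complex \<times> complex).
     fst (snd q) + fst (fst q) *\<^sub>R (fst (snd (snd q)) - fst (snd q))
        + snd (fst q) *\<^sub>R (snd (snd (snd q)) - fst (snd q)) = 0}"
  have "closed ?S"
    by (intro closed_Collect_conj closed_Collect_le continuous_intros)
  moreover have "?S \<subseteq> cbox (0, 0) (1, 1)"
    by (auto simp: mem_box Basis_prod_def)
  ultimately have "compact ?S"
    by (meson bounded_cbox bounded_subset compact_eq_bounded_closed)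
  moreover have "closed ?T"
    by (intro closed_Collect_eq continuous_intros)
  ultimately have "closed {y. \<exists>x. x \<in> ?S \<and> (x, y) \<in> ?T}"
    by (rule closed_compact_projection)
  also have "{y. \<exists>x. x \<in> ?S \<and> (x, y) \<in> ?T} = {(a :: complex, b, c). 0 \<in> convex hull {a, b, c}}"
    by (simp add: convex_hull_3_alt set_eq_iff conj_ac eq_commute[of 0])
  finally show ?thesis .
qed

lemma zero_in_hull_measurable [measurable]:
  "{(a :: complex, b, c). 0 \<in> convex hull {a, b, c}} \<in> sets (borel \<Otimes>\<^sub>M (borel \<Otimes>\<^sub>M borel))"
  unfolding borel_prod by (rule borel_closed[OF closed_zero_in_hull])

text \<open>The exceptional points form the line through 0 and \<open>a\<close>, written as the
  hyperplane normal to \<open>a\<close> turned by a right angle.\<close>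

lemma AE_cross_nonzero:
  assumes "a \<noteq> 0"
  shows "AE b in lborel. cross a b \<noteq> 0"
proof -
  have "negligible {b. Complex (- Im a) (Re a) \<bullet> b = 0}"
    by (rule negligible_hyperplane) (use assms in \<open>auto simp: complex_eq_iff\<close>)
  also have "{b. Complex (- Im a) (Re a) \<bullet> b = 0} = {b. cross a b = 0}"
    by (auto simp: cross_def inner_complex_def)
  finally have "{b. cross a b = 0} \<in> null_sets lebesgue"
    by (simp add: negligible_iff_null_sets)
  moreover have "{b. cross a b = 0} \<in> sets lborel" by simp
  ultimately have "{b. cross a b = 0} \<in> null_sets lborel"
    by (simp add: null_sets_def)
  then show ?thesis
    by (auto dest: AE_not_in)
qed

text \<open>The integral form makes measurability in \<open>a\<close> available.\<close>

lemma emeasure_cross_pos: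
  assumes [measurable_cong]: "sets M = sets borel"
  shows "emeasure M {b. cross a b > 0} = (\<integral>\<^sup>+b. of_bool (cross a b > 0) \<partial>M)"
proof -
  have "{b. cross a b > 0} \<in> sets M" unfolding assms by measurable
  then have "emeasure M {b. cross a b > 0} = (\<integral>\<^sup>+b. indicator {b. cross a b > 0} b \<partial>M)"
    by simp
  then show ?thesis by (simp add: indicator_def)
qed

text \<open>The partition into four cases is integrated over three independent points. Given
  \<open>a\<close>, the other two lie on its left independently, so that case contributes the
  integral of a square; the two remaining cases agree with it by symmetry.\<close>

lemma nn_integral_hull_left:
  fixes M :: "complex measure"
  assumes "sigma_finite_measure M"
    and sets_M [measurable_cong]: "sets M = sets borel" and total: "emeasure M (space M) = 1"
    and nonzero: "AE a in M. a \<noteq> 0" and line: "\<And>a. a \<noteq> 0 \<Longrightarrow> AE b in M. cross a b \<noteq> 0"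
  shows "(\<integral>\<^sup>+a. \<integral>\<^sup>+b. \<integral>\<^sup>+c. indicator {(a, b, c). 0 \<in> convex hull {a, b, c}} (a, b, c) \<partial>M \<partial>M \<partial>M)
     + 3 * (\<integral>\<^sup>+a. (emeasure M {b. cross a b > 0})\<^sup>2 \<partial>M) = 1"
proof -
  interpret sigma_finite_measure M by fact
  interpret pair_sigma_finite M M ..
  let ?Q = "{(a :: complex, b, c). 0 \<in> convex hull {a, b, c}}"
  define k :: "complex \<Rightarrow> complex \<Rightarrow> ennreal" where "k a b = of_bool (cross a b > 0)" for a b
  define h where "h a = (\<integral>\<^sup>+b. k a b \<partial>M)" for a
  have k_meas [measurable (raw)]: "(\<lambda>x. k (f x) (g x)) \<in> borel_measurable N"
    if [measurable]: "f \<in> borel_measurable N" "g \<in> borel_measurable N"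
    for f g :: "'b \<Rightarrow> complex" and N
    unfolding k_def by measurable
  have h_meas [measurable]: "h \<in> borel_measurable borel"
    unfolding h_def by measurable
  have h_eq: "h a = emeasure M {b. cross a b > 0}" for a
    by (simp add: h_def k_def emeasure_cross_pos sets_M)
  let ?J = "\<integral>\<^sup>+a. h a * h a \<partial>M"
  have 1: "(\<integral>\<^sup>+a. \<integral>\<^sup>+b. \<integral>\<^sup>+c. k a b * k a c \<partial>M \<partial>M \<partial>M) = ?J"
    by (simp add: nn_integral_cmult nn_integral_multc flip: h_def)
  have "(\<integral>\<^sup>+a. \<integral>\<^sup>+b. \<integral>\<^sup>+c. k b c * k b a \<partial>M \<partial>M \<partial>M) = (\<integral>\<^sup>+a. \<integral>\<^sup>+b. h b * k b a \<partial>M \<partial>M)"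
    by (simp add: nn_integral_multc flip: h_def)
  \<comment> \<open>Fubini moves the vertex with both others on its left to the outermost integral;
    the same is done below for \<open>c\<close>.\<close>
  also have "\<dots> = (\<integral>\<^sup>+b. \<integral>\<^sup>+a. h b * k b a \<partial>M \<partial>M)"
    by (rule Fubini') measurable
  also have "\<dots> = ?J"
    by (simp add: nn_integral_cmult flip: h_def)
  finally have 2: "(\<integral>\<^sup>+a. \<integral>\<^sup>+b. \<integral>\<^sup>+c. k b c * k b a \<partial>M \<partial>M \<partial>M) = ?J" .
  have "(\<integral>\<^sup>+a. \<integral>\<^sup>+b. \<integral>\<^sup>+c. k c a * k c b \<partial>M \<partial>M \<partial>M) = (\<integral>\<^sup>+a. \<integral>\<^sup>+c. \<integral>\<^sup>+b. k c a * k c b \<partial>M \<partial>M \<partial>M)"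
    by (intro nn_integral_cong Fubini') measurable
  also have "\<dots> = (\<integral>\<^sup>+a. \<integral>\<^sup>+c. k c a * h c \<partial>M \<partial>M)"
    by (simp add: nn_integral_cmult flip: h_def)
  also have "\<dots> = (\<integral>\<^sup>+c. \<integral>\<^sup>+a. k c a * h c \<partial>M \<partial>M)"
    by (rule Fubini') measurable
  also have "\<dots> = ?J"
    by (simp add: nn_integral_multc flip: h_def)
  finally have 3: "(\<integral>\<^sup>+a. \<integral>\<^sup>+b. \<integral>\<^sup>+c. k c a * k c b \<partial>M \<partial>M \<partial>M) = ?J" .
  let ?F = "\<lambda>a b c. indicator ?Q (a, b, c) + k a b * k a c + k b c * k b a + k c a * k c b"
  have "1 = (\<integral>\<^sup>+a. \<integral>\<^sup>+b. \<integral>\<^sup>+c. 1 \<partial>M \<partial>M \<partial>M)"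
    by (simp add: total)
  \<comment> \<open>The partition needs all three cross products nonzero: \<open>a\<close> avoids
    the origin, \<open>b\<close> the line of \<open>a\<close>, and \<open>c\<close> the lines of
    both. The point \<open>b\<close> is then nonzero as well, so its line is again null.\<close>
  also have "\<dots> = (\<integral>\<^sup>+a. \<integral>\<^sup>+b. \<integral>\<^sup>+c. ?F a b c \<partial>M \<partial>M \<partial>M)"
  proof (rule nn_integral_cong_AE, use nonzero in eventually_elim)
    case a: (elim a)
    show ?case
    proof (rule nn_integral_cong_AE, use line[OF a] in eventually_elim)
      case ab: (elim b)
      then have b: "b \<noteq> 0" by (auto simp: cross_def)
      show ?case
      proof (rule nn_integral_cong_AE, use line[OF a] line[OF b] in eventually_elim)
        case (elim c)
        then show ?case
          using hull_left_partition[of a b c] ab cross_commute[of a c] by (simp add: k_def)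
      qed
    qed
  qed
  also have "\<dots> = (\<integral>\<^sup>+a. \<integral>\<^sup>+b. \<integral>\<^sup>+c. indicator ?Q (a, b, c) \<partial>M \<partial>M \<partial>M) + ?J + ?J + ?J"
    by (simp add: nn_integral_add 1 2 3)
  finally have "(\<integral>\<^sup>+a. \<integral>\<^sup>+b. \<integral>\<^sup>+c. indicator ?Q (a, b, c) \<partial>M \<partial>M \<partial>M) + 3 * ?J = 1"
    using distrib_right[of 1 2 ?J] by (simp add: add.assoc mult_2)
  then show ?thesis
    by (simp add: h_eq power2_eq_square)
qed

subsection \<open>The probability as an integral over the boundary\<close>

text \<open>The bridge from Lebesgue integrals over half-open windows to the gauge integrals over
  closed intervals in \<open>arc_int\<close>; the extra endpoint is null.\<close>

lemma nn_integral_Ico_eq_integral: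
  fixes F :: "real \<Rightarrow> real"
  assumes cont: "continuous_on {c..d} F" and nonneg: "\<And>x. x \<in> {c..d} \<Longrightarrow> 0 \<le> F x"
  shows "(\<integral>\<^sup>+x\<in>{c..<d}. ennreal (F x) \<partial>lborel) = ennreal (integral {c..d} F)"
proof -
  have "(\<integral>\<^sup>+x\<in>{c..<d}. ennreal (F x) \<partial>lborel) = (\<integral>\<^sup>+x. ennreal (indicator {c..d} x *\<^sub>R F x) \<partial>lborel)"
    using AE_lborel_singleton[of d]
    by (intro nn_integral_cong_AE, eventually_elim) (auto simp: indicator_def)
  also have "\<dots> = ennreal (integral {c..d} F)"
  proof (rule nn_integral_has_integral_lborel)
    show "(\<lambda>x. indicator {c..d} x *\<^sub>R F x) \<in> borel_measurable borel"
      by (rule borel_measurable_continuous_on_indicator[OF _ cont]) simp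
    have "(F has_integral integral {c..d} F) {c..d}"
      using integrable_continuous_real[OF cont] by (rule integrable_integral)
    then show "((\<lambda>x. indicator {c..d} x *\<^sub>R F x) has_integral integral {c..d} F) UNIV"
      using has_integral_restrict_UNIV[of "{c..d}" F]
      by (simp add: indicator_def of_bool_def if_distrib if_distribR cong: if_cong)
  qed (use nonneg in \<open>auto simp: indicator_def\<close>)
  finally show ?thesis .
qed

lemma nn_integral_lborel_triple:
  fixes f :: "'a::euclidean_space \<times> 'b::euclidean_space \<times> 'c::euclidean_space \<Rightarrow> ennreal"
  assumes f: "f \<in> borel_measurable borel"
  shows "(\<integral>\<^sup>+p. f p \<partial>lborel) = (\<integral>\<^sup>+a. \<integral>\<^sup>+b. \<integral>\<^sup>+c. f (a, b, c) \<partial>lborel \<partial>lborel \<partial>lborel)"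
proof -
  have "(\<integral>\<^sup>+p. f p \<partial>lborel) = (\<integral>\<^sup>+a. \<integral>\<^sup>+q. f (a, q) \<partial>lborel \<partial>lborel)"
    using f by (subst lborel.nn_integral_fst) (auto simp: lborel_prod)
  also have "\<dots> = (\<integral>\<^sup>+a. \<integral>\<^sup>+b. \<integral>\<^sup>+c. f (a, b, c) \<partial>lborel \<partial>lborel \<partial>lborel)"
  proof (rule nn_integral_cong)
    fix a
    have "(\<lambda>q. f (a, q)) \<in> borel_measurable borel"
      by (rule measurable_compose[OF _ f]) (intro borel_measurable_continuous_onI continuous_intros)
    then show "(\<integral>\<^sup>+q. f (a, q) \<partial>lborel) = (\<integral>\<^sup>+b. \<integral>\<^sup>+c. f (a, b, c) \<partial>lborel \<partial>lborel)"
      by (subst lborel.nn_integral_fst[where f = "\<lambda>q. f (a, q)"]) (auto simp: lborel_prod)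
  qed
  finally show ?thesis .
qed

lemma integral_split_half:
  fixes F :: "real \<Rightarrow> real"
  assumes "continuous_on UNIV F" "0 \<le> p"
  shows "integral {u..u + 2 * p} F = integral {u..u + p} F + integral {u + p..u + p + p} F"
  using Henstock_Kurzweil_Integration.integral_combine[of u "u + p" "u + 2 * p" F] assms
  by (simp add: integrable_continuous_real continuous_on_subset[OF assms(1)] algebra_simps)

section \<open>The boundary density and the half-turn area\<close>

locale unit_polar_curve = polar_curve +
  assumes area: "measure lborel (polar_region r) = 1"
begin

definition g :: "real \<Rightarrow> real" where "g \<theta> = (r \<theta>)\<^sup>2 / 2"

abbreviation "H \<equiv> Hfun r"

lemma g_nonneg: "0 \<le> g \<theta>" and g_cont: "continuous_on S g"
  unfolding g_def by (auto intro!: continuous_intros continuous_on_subset[OF cont])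

lemma arc_int_eq: "arc_int r a b \<phi> = integral {a..b} (\<lambda>t. \<phi> t * g t)"
  by (simp add: arc_int_def g_def)

lemma H_eq: "H t = integral {t..t + pi} g"
  by (simp add: Hfun_def arc_int_eq)

lemma H_nonneg: "0 \<le> H t"
  unfolding H_eq by (intro integral_nonneg integrable_continuous_real g_cont g_nonneg)

lemma emeasure_polar_region: "emeasure lborel (polar_region r) = 1"
  using area emeasure_compact_finite[OF compact_polar_region]
  by (simp add: emeasure_eq_ennreal_measure top.not_eq_extremum)

lemma integral_g_turn: "integral {c..c + 2 * pi} g = 1"
proof -
  have "1 = (\<integral>\<^sup>+z\<in>polar_region r. 1 \<partial>lborel)"
    by (simp add: emeasure_polar_region)
  also have "\<dots> = (\<integral>\<^sup>+\<theta>\<in>{c..<c + 2 * pi}. ennreal (g \<theta>) \<partial>lborel)"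
    by (subst nn_integral_polar_region[where c = c and \<phi> = "\<lambda>_. 1"]) (auto simp: g_def)
  also have "\<dots> = ennreal (integral {c..c + 2 * pi} g)"
    by (intro nn_integral_Ico_eq_integral g_cont g_nonneg)
  finally show ?thesis
    by (metis ennreal_eq_1)
qed

lemma H_shift: "H (t + pi) = 1 - H t"
proof -
  have "integral {t..t + pi} g + integral {t + pi..t + 2 * pi} g = integral {t..t + 2 * pi} g"
    by (rule Henstock_Kurzweil_Integration.integral_combine) (auto intro: integrable_continuous_real g_cont)
  then show ?thesis
    using integral_g_turn[of t] by (simp add: H_eq algebra_simps)
qed

text \<open>Both endpoints of the arc move with \<open>t\<close>, so the fundamental theorem of
  calculus gives the density at the far end minus the density at the near end.\<close>

lemma H_deriv: "(H has_real_derivative g (t + pi) - g t) (at t)"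
proof -
  \<comment> \<open>The base point \<open>t - 1\<close> only has to lie left of \<open>t\<close>:
    both \<open>s\<close> and \<open>s + pi\<close> then stay to its right for \<open>s\<close> near
    \<open>t\<close>.\<close>
  define G where "G s = integral {t - 1..s} g" for s
  have G: "(G has_real_derivative g s) (at s)" if "t - 1 < s" for s
  proof -
    have "(G has_real_derivative g s) (at s within {t - 1..s + 1})"
      unfolding G_def by (rule integral_has_real_derivative) (use that g_cont in auto)
    then show ?thesis
      using that by (subst (asm) at_within_interior) auto
  qed
  have "((\<lambda>s. G (s + pi) - G s) has_real_derivative g (t + pi) - g t) (at t)"
    using G[of t] G[of "t + pi"] pi_gt_zero
    by (auto intro!: derivative_eq_intros simp: DERIV_shift)
  moreover have "eventually (\<lambda>s. G (s + pi) - G s = H s) (nhds t)"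
  proof -
    have "eventually (\<lambda>s. s \<in> {t - 1<..}) (nhds t)"
      by (rule eventually_nhds_in_open) auto
    then show ?thesis
    proof eventually_elim
      case (elim s)
      have "integral {t - 1..s} g + integral {s..s + pi} g = integral {t - 1..s + pi} g"
        by (rule Henstock_Kurzweil_Integration.integral_combine)
           (use elim in \<open>auto intro: integrable_continuous_real g_cont\<close>)
      then show ?case by (simp add: G_def H_eq)
    qed
  qed
  ultimately show ?thesis
    by (subst (asm) DERIV_cong_ev) auto
qed

lemma H_cont: "continuous_on S H"
  using H_deriv by (meson DERIV_isCont continuous_at_imp_continuous_on)

text \<open>Lying to the left depends only on the angle. With the window starting at
  \<open>\<alpha>\<close>, the sine is positive exactly strictly inside the first half turn; the
  start itself is a null set.\<close>

lemma emeasure_left: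
  assumes "0 < \<rho>"
  shows "(\<integral>\<^sup>+b\<in>polar_region r. indicator {b. cross (of_real \<rho> * cis \<alpha>) b > 0} b \<partial>lborel) = ennreal (H \<alpha>)"
proof -
  have "(\<integral>\<^sup>+b\<in>polar_region r. indicator {b. cross (of_real \<rho> * cis \<alpha>) b > 0} b \<partial>lborel)
      = (\<integral>\<^sup>+\<theta>\<in>{\<alpha>..<\<alpha> + 2 * pi}. indicator {\<theta>. sin (\<theta> - \<alpha>) > 0} \<theta> * ennreal ((r \<theta>)\<^sup>2 / 2) \<partial>lborel)"
    using assms by (intro nn_integral_polar_region) (auto simp: indicator_def cross_polar zero_less_mult_iff dest: mult_pos_pos[OF assms])
  also have "\<dots> = (\<integral>\<^sup>+\<theta>\<in>{\<alpha>..<\<alpha> + pi}. ennreal (g \<theta>) \<partial>lborel)"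
    using AE_lborel_singleton[of \<alpha>]
  proof (intro nn_integral_cong_AE, eventually_elim)
    case (elim \<theta>)
    have "sin (\<theta> - \<alpha>) > 0 \<longleftrightarrow> \<theta> < \<alpha> + pi" if "\<alpha> \<le> \<theta>" "\<theta> < \<alpha> + 2 * pi"
    proof (cases "\<theta> < \<alpha> + pi")
      case True
      then show ?thesis using sin_gt_zero[of "\<theta> - \<alpha>"] elim that by auto
    next
      case False
      then show ?thesis using sin_le_zero[of "\<theta> - \<alpha>"] that by auto
    qed
    then show ?case using pi_gt_zero by (auto simp: indicator_def g_def)
  qed
  also have "\<dots> = ennreal (H \<alpha>)"
    unfolding H_eq by (intro nn_integral_Ico_eq_integral g_cont g_nonneg)
  finally show ?thesis .
qed

text \<open>Lebesgue measure restricted to the region is the law of a uniform point, since the area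
  is 1. The general identity applies to it, and polar coordinates turn the squared area on the left
  into \<open>(H t)\<^sup>2\<close>. The starting angle \<open>c\<close> is arbitrary.\<close>

lemma triangle_prob_eq:
  "triangle_prob (polar_region r) = 1 - 3 * integral {c..c + 2 * pi} (\<lambda>t. (H t)\<^sup>2 * g t)"
proof -
  let ?R = "polar_region r" and ?K = "integral {c..c + 2 * pi} (\<lambda>t. (H t)\<^sup>2 * g t)"
  let ?Q = "{(a :: complex, b, c). 0 \<in> convex hull {a, b, c}}"
  let ?X = "{(a :: complex, b :: complex, c :: complex). a \<in> ?R \<and> b \<in> ?R \<and> c \<in> ?R \<and> 0 \<in> convex hull {a, b, c}}"
  define M where "M = density lborel (indicator ?R :: complex \<Rightarrow> ennreal)"
  have sets_M [measurable_cong]: "sets M = sets borel" and [simp]: "space M = UNIV"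
    by (auto simp: M_def)
  have nnM: "(\<integral>\<^sup>+z. f z \<partial>M) = (\<integral>\<^sup>+z\<in>?R. f z \<partial>lborel)" if "f \<in> borel_measurable borel" for f
    using that unfolding M_def by (subst nn_integral_density) (auto simp: mult.commute)
  have total: "emeasure M (space M) = 1"
    by (simp add: M_def emeasure_density emeasure_polar_region)
  interpret finite_measure M
    by (rule finite_measureI) (use total in simp)
  have AE_M: "AE z in M. P z" if "AE z in lborel. P z" for P
    unfolding M_def using that by (subst AE_density) auto
  have X_eq: "?X = (?R \<times> ?R \<times> ?R) \<inter> ?Q" by auto
  have X [measurable]: "?X \<in> sets (borel \<Otimes>\<^sub>M (borel \<Otimes>\<^sub>M borel))"
    unfolding X_eq by measurable
  have left: "emeasure M {b. cross a b > 0} = (\<integral>\<^sup>+b\<in>?R. indicator {b. cross a b > 0} b \<partial>lborel)" for a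
    by (subst nnM[symmetric]) (auto simp flip: nn_integral_indicator)
  have left_meas: "(\<lambda>a. (emeasure M {b. cross a b > 0})\<^sup>2) \<in> borel_measurable borel"
    by (simp add: emeasure_cross_pos sets_M)
  have "(\<integral>\<^sup>+a. (emeasure M {b. cross a b > 0})\<^sup>2 \<partial>M) = (\<integral>\<^sup>+a\<in>?R. (emeasure M {b. cross a b > 0})\<^sup>2 \<partial>lborel)"
    by (rule nnM[OF left_meas])
  also have "\<dots> = (\<integral>\<^sup>+\<theta>\<in>{c..<c + 2 * pi}. ennreal ((H \<theta>)\<^sup>2) * ennreal ((r \<theta>)\<^sup>2 / 2) \<partial>lborel)"
    by (intro nn_integral_polar_region left_meas)
       (simp add: left emeasure_left ennreal_power H_nonneg)
  also have "\<dots> = (\<integral>\<^sup>+\<theta>\<in>{c..<c + 2 * pi}. ennreal ((H \<theta>)\<^sup>2 * g \<theta>) \<partial>lborel)"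
    by (simp add: g_def flip: ennreal_mult)
  also have "\<dots> = ennreal ?K"
    by (intro nn_integral_Ico_eq_integral continuous_intros H_cont g_cont) (simp add: g_nonneg)
  finally have J: "(\<integral>\<^sup>+a. (emeasure M {b. cross a b > 0})\<^sup>2 \<partial>M) = ennreal ?K" .
  have "emeasure lborel ?X = (\<integral>\<^sup>+a. \<integral>\<^sup>+b. \<integral>\<^sup>+c. indicator ?X (a, b, c) \<partial>lborel \<partial>lborel \<partial>lborel)"
    using X unfolding borel_prod
    by (subst nn_integral_lborel_triple[symmetric], simp) (rule nn_integral_indicator[symmetric], simp)
  \<comment> \<open>The restriction of each vertex to the region moves from the indicator of the
    event into the measure \<open>M\<close>.\<close>
  also have "\<dots> = (\<integral>\<^sup>+a. \<integral>\<^sup>+b. \<integral>\<^sup>+c. indicator ?Q (a, b, c) \<partial>M \<partial>M \<partial>M)"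
  proof -
    have c: "(\<integral>\<^sup>+c. indicator ?Q (a, b, c) \<partial>M) = (\<integral>\<^sup>+c\<in>?R. indicator ?Q (a, b, c) \<partial>lborel)" for a b
      by (rule nnM) measurable
    have b: "(\<integral>\<^sup>+b. \<integral>\<^sup>+c. indicator ?Q (a, b, c) \<partial>M \<partial>M)
        = (\<integral>\<^sup>+b\<in>?R. (\<integral>\<^sup>+c. indicator ?Q (a, b, c) \<partial>M) \<partial>lborel)" for a
      by (rule nnM) measurable
    have a: "(\<integral>\<^sup>+a. \<integral>\<^sup>+b. \<integral>\<^sup>+c. indicator ?Q (a, b, c) \<partial>M \<partial>M \<partial>M)
        = (\<integral>\<^sup>+a\<in>?R. (\<integral>\<^sup>+b. \<integral>\<^sup>+c. indicator ?Q (a, b, c) \<partial>M \<partial>M) \<partial>lborel)"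
      by (rule nnM) measurable
    show ?thesis
      unfolding a unfolding b unfolding c by (auto intro!: nn_integral_cong simp: indicator_def)
  qed
  finally have "emeasure lborel ?X + 3 * ennreal ?K = 1"
    using nn_integral_hull_left[of M] total J AE_M[OF AE_lborel_singleton] AE_M[OF AE_cross_nonzero]
    by (simp add: sigma_finite_measure_axioms sets_M)
  moreover have K: "0 \<le> ?K"
    by (intro integral_nonneg integrable_continuous_real continuous_intros H_cont g_cont) (simp add: g_nonneg)
  ultimately have eq: "emeasure lborel ?X + ennreal (3 * ?K) = 1"
    by (simp add: ennreal_mult)
  \<comment> \<open>Finiteness is read off from the sum being 1; it is needed before passing to the
    real-valued \<open>measure\<close>.\<close>
  then have "emeasure lborel ?X \<noteq> top" by auto
  then have "emeasure lborel ?X = ennreal (measure lborel ?X)"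
    by (rule emeasure_eq_ennreal_measure)
  with eq K have "ennreal (measure lborel ?X + 3 * ?K) = 1" by simp
  then have "measure lborel ?X = 1 - 3 * ?K"
    by (simp only: ennreal_eq_1)
  then show ?thesis
    by (simp add: triangle_prob_def area)
qed

section \<open>Folding the full turn onto a half turn\<close>

lemma triangle_prob_half:
  "triangle_prob (polar_region r) =
     - (H u)\<^sup>2 * (3 - 2 * H u) + 6 * integral {u..u + pi} (\<lambda>t. H t * (1 - H t) * g t)"
proof -
  let ?I = "\<lambda>F. integral {u..u + pi} F"
  let ?F5 = "\<lambda>t. (1 - H t)\<^sup>2 * (g (t + pi) - g t)"
  have gs: "continuous_on S (\<lambda>t. g (t + pi))" for S
    by (rule continuous_on_compose2[OF g_cont[of UNIV]]) (auto intro!: continuous_intros)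
  note int = integrable_continuous_real continuous_intros H_cont g_cont gs
  have "integral {u..u + 2 * pi} (\<lambda>t. (H t)\<^sup>2 * g t)
    = ?I (\<lambda>t. (H t)\<^sup>2 * g t) + integral {u + pi..u + pi + pi} (\<lambda>t. (H t)\<^sup>2 * g t)"
    by (intro integral_split_half continuous_intros H_cont g_cont) simp
  also have "integral {u + pi..u + pi + pi} (\<lambda>t. (H t)\<^sup>2 * g t) = ?I (\<lambda>t. (H (t + pi))\<^sup>2 * g (t + pi))"
    by (subst integral_shift_Icc_real[symmetric]) (simp add: o_def add.commute)
  also have "\<dots> = ?I (\<lambda>t. (1 - H t)\<^sup>2 * g (t + pi))"
    by (simp add: H_shift)
  also have "?I (\<lambda>t. (H t)\<^sup>2 * g t) + \<dots> = ?I (\<lambda>t. (H t)\<^sup>2 * g t + (1 - H t)\<^sup>2 * g (t + pi))"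
    by (subst integral_add) (auto intro!: int)
  \<comment> \<open>This uses \<open>g (t + pi) = g t + (g (t + pi) - g t)\<close> and the fact that
    the squares of \<open>H t\<close> and \<open>1 - H t\<close> add up to
    \<open>1 - 2 * (H t * (1 - H t))\<close>.\<close>
  also have "\<dots> = ?I (\<lambda>t. g t - 2 * (H t * (1 - H t) * g t) + ?F5 t)"
    by (intro integral_cong) (simp add: algebra_simps power2_eq_square)
  also have "\<dots> = ?I (\<lambda>t. g t - 2 * (H t * (1 - H t) * g t)) + ?I ?F5"
    by (rule integral_add) (auto intro!: int)
  also have "?I (\<lambda>t. g t - 2 * (H t * (1 - H t) * g t)) = H u - 2 * ?I (\<lambda>t. H t * (1 - H t) * g t)"
    by (subst integral_diff) (auto intro!: int simp flip: H_eq)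
  \<comment> \<open>By \<open>H_deriv\<close> the integrand is the derivative of minus a third of
    the cube of \<open>1 - H t\<close>. At the upper end
    \<open>1 - H (u + pi) = H u\<close>.\<close>
  also have "?I ?F5 = (1 - H u) ^ 3 / 3 - (H u) ^ 3 / 3"
  proof -
    have "(?F5 has_integral - ((1 - H (u + pi)) ^ 3 / 3) - - ((1 - H u) ^ 3 / 3)) {u..u + pi}"
    proof (rule fundamental_theorem_of_calculus)
      fix t
      have "((\<lambda>t. - ((1 - H t) ^ 3 / 3)) has_real_derivative ?F5 t) (at t within {u..u + pi})"
        by (auto intro!: derivative_eq_intros DERIV_subset[OF H_deriv]) (simp add: algebra_simps)
      then show "((\<lambda>t. - ((1 - H t) ^ 3 / 3)) has_vector_derivative ?F5 t) (at t within {u..u + pi})"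
        by (simp add: has_real_derivative_iff_has_vector_derivative)
    qed simp
    then show ?thesis by (auto simp: H_shift has_integral_iff)
  qed
  \<comment> \<open>With \<open>x = H u\<close>, the boundary terms combine as
    \<open>1 - 3 * x - (1 - x) ^ 3 + x ^ 3\<close>, which equals
    \<open>- (x ^ 2) * (3 - 2 * x)\<close>.\<close>
  finally show ?thesis
    using triangle_prob_eq[of u] by (simp add: field_simps power2_eq_square power3_eq_cube)
qed

text \<open>Completing the square turns \<open>H * (1 - H)\<close> into
  \<open>1 / 4 - (1 / 2 - H) ^ 2\<close>; the constant adds \<open>3 * x / 2\<close> for
  \<open>x = H u\<close>, which completes the boundary polynomial to
  \<open>1 / 4 - (1 - 2 * x) ^ 3 / 4\<close>.\<close>

lemma triangle_prob_half':
  "triangle_prob (polar_region r) =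
     1 / 4 - (1 - 2 * H u) ^ 3 / 4 - 6 * integral {u..u + pi} (\<lambda>t. (1 / 2 - H t)\<^sup>2 * g t)"
proof -
  have "integral {u..u + pi} (\<lambda>t. H t * (1 - H t) * g t)
      = integral {u..u + pi} (\<lambda>t. 1 / 4 * g t - (1 / 2 - H t)\<^sup>2 * g t)"
    by (intro integral_cong) (simp add: field_simps power2_eq_square)
  also have "\<dots> = H u / 4 - integral {u..u + pi} (\<lambda>t. (1 / 2 - H t)\<^sup>2 * g t)"
    by (subst integral_diff)
       (auto intro!: integrable_continuous_real continuous_intros H_cont g_cont simp flip: H_eq)
  finally show ?thesis
    using triangle_prob_half[of u] by (simp add: field_simps power2_eq_square power3_eq_cube)
qed

text \<open>The values at 0 and \<open>pi\<close> add up to 1, so they lie on opposite sides of 1/2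
  or both equal it; the intermediate value theorem applies in either order.\<close>

lemma ex_H_half: "\<exists>u. H u = 1 / 2"
proof -
  have "\<exists>u. 0 \<le> u \<and> u \<le> pi \<and> H u = 1 / 2" if "H 0 \<le> 1 / 2"
    using that H_shift[of 0] by (intro IVT') (auto intro: H_cont)
  moreover have "\<exists>u. 0 \<le> u \<and> u \<le> pi \<and> H u = 1 / 2" if "1 / 2 \<le> H 0"
    using that H_shift[of 0] by (intro IVT2') (auto intro: H_cont)
  ultimately show ?thesis by (meson linear)
qed

end

theorem theorem1p1:
  fixes r :: "real \<Rightarrow> real"
  assumes pos: "\<And>\<theta>. r \<theta> > 0"
    and cont: "continuous_on UNIV r"
    and periodic: "\<And>\<theta>. r (\<theta> + 2 * pi) = r \<theta>"
    and pwd: "r piecewise_differentiable_on {0..2 * pi}"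
    and area: "measure lborel (polar_region r) = 1"
  shows
    "(\<forall>\<theta>u. let x = arc_int r \<theta>u (\<theta>u + pi) (\<lambda>_. 1) in
        triangle_prob (polar_region r) =
          - x\<^sup>2 * (3 - 2 * x)
          + 6 * arc_int r \<theta>u (\<theta>u + pi) (\<lambda>t. Hfun r t * (1 - Hfun r t))) \<and>
     (\<forall>\<theta>u. let x = arc_int r \<theta>u (\<theta>u + pi) (\<lambda>_. 1) in
        triangle_prob (polar_region r) =
          1 / 4 - (1 - 2 * x) ^ 3 / 4
          - 6 * arc_int r \<theta>u (\<theta>u + pi) (\<lambda>t. (1 / 2 - Hfun r t)\<^sup>2)) \<and>
     (\<exists>\<theta>u. triangle_prob (polar_region r) =
          1 / 4 - 6 * arc_int r \<theta>u (\<theta>u + pi) (\<lambda>t. (1 / 2 - Hfun r t)\<^sup>2)) \<and>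
     triangle_prob (polar_region r) =
          - 1 / 2 + 3 * arc_int r 0 (2 * pi) (\<lambda>t. Hfun r t * (1 - Hfun r t)) \<and>
     triangle_prob (polar_region r) =
          1 / 4 - 3 * arc_int r 0 (2 * pi) (\<lambda>t. (1 / 2 - Hfun r t)\<^sup>2)"
proof -
  interpret unit_polar_curve r
    by unfold_locales (use assms in auto)
  let ?P = "triangle_prob (polar_region r)"
  have x: "arc_int r u (u + pi) (\<lambda>_. 1) = H u" for u
    by (simp add: Hfun_def)
  have Hpi: "H pi = 1 - H 0" using H_shift[of 0] by simp
  have "\<exists>u. ?P = 1 / 4 - 6 * integral {u..u + pi} (\<lambda>t. (1 / 2 - H t)\<^sup>2 * g t)"
  proof -
    \<comment> \<open>A line through the origin that halves the area makes the cubic term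
      vanish.\<close>
    obtain u where "H u = 1 / 2" using ex_H_half by blast
    then show ?thesis using triangle_prob_half'[of u] by (intro exI[of _ u]) simp
  qed
  moreover
  \<comment> \<open>The formulas over the full boundary are the means of the half-boundary ones at \<open>0\<close> and \<open>\<pi>\<close>.\<close>
  have "?P = - 1 / 2 + 3 * integral {0..2 * pi} (\<lambda>t. H t * (1 - H t) * g t)"
    using triangle_prob_half[of 0] triangle_prob_half[of pi] Hpi
      integral_split_half[of "\<lambda>t. H t * (1 - H t) * g t" pi 0]
    by (simp add: continuous_intros H_cont g_cont) (simp add: field_simps power2_eq_square)
  \<comment> \<open>The cubic terms at 0 and \<open>pi\<close> are opposite, as
    \<open>1 - 2 * H pi = - (1 - 2 * H 0)\<close>, and cancel in the mean.\<close>
  moreover have "?P = 1 / 4 - 3 * integral {0..2 * pi} (\<lambda>t. (1 / 2 - H t)\<^sup>2 * g t)"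
    using triangle_prob_half'[of 0] triangle_prob_half'[of pi] Hpi
      integral_split_half[of "\<lambda>t. (1 / 2 - H t)\<^sup>2 * g t" pi 0]
    by (simp add: continuous_intros H_cont g_cont) (simp add: field_simps power3_eq_cube)
  ultimately show ?thesis
    using triangle_prob_half triangle_prob_half' unfolding Let_def x unfolding arc_int_eq by blast
qed

end
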